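(* Let $\mathbb{L}^3$ be $\mathbb{R}^3$ with coordinates $(x,y,z)$ and the metric $g=-2\,dx\,dy+dz^2$. Let $u$ be a function of type I, II, III or IV defined on a domain $\Omega\subset\mathbb{R}^2$. Then the surface $\psi:\Omega\to\mathbb{L}^3$, $\psi(y,z)=(u(y,z),y,z)$, with the induced metric $\psi^*g$, is flat, i.e. its Gaussian curvature is $K=0$.
   Context: $\log$ denotes the natural logarithm. The types are: I. $u(y,z)=-2\lambda^2y+4\lambda^2\log\left(\cosh\left(\frac{z-z_0}{2\lambda}\right)\right)+a_0$, with $\lambda>0$, $a_0,z_0\in\mathbb{R}$; II. $u(y,z)=a_1e^{-2y}-\frac{b_1^2}{2}y+b_1z+b_0$, with $a_1,b_1,b_0\in\mathbb{R}$, $a_1\neq0$; III. $u(y,z)=2\lambda^2y-4\lambda^2\log\left|\cos\left(\frac{z-z_0}{2\lambda}\right)\right|+b_0$, with $\lambda>0$, $b_0,z_0\in\mathbb{R}$; IV. $u(y,z)=-2\lambda^2y+4\lambda^2\log\left|\sinh\left(\frac{z-z_0}{2\lambda}\right)\right|+a_0$, with $\lambda>0$, $a_0,z_0\in\mathbb{R}$. The Gaussian curvature is $K=\frac{eg-f^2}{EG-F^2}$, where $E,F,G$ and $e,f,g$ (here $g$ is a coefficient, not the metric) are the coefficients of the first and second fundamental forms with respect to the basis $(\psi_y,\psi_z)$ and a unit normal $N$: $E=\langle\psi_y,\psi_y\rangle$, $F=\langle\psi_y,\psi_z\rangle$, $G=\langle\psi_z,\psi_z\rangle$, $e=\langle N,\psi_{yy}\rangle$,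 $f=\langle N,\psi_{yz}\rangle$, $g=\langle N,\psi_{zz}\rangle$. Here $\langle\cdot,\cdot\rangle$ is the metric of $\mathbb{L}^3$. *)

theory Defs
  imports "HOL-Analysis.Analysis"
begin

text \<open>The metric \<open>-2 dx dy + dz\<^sup>2\<close> of \<open>L\<^sup>3\<close>, polarised; \<open>dx dy\<close> is the symmetric product.\<close>

definition lorentz :: "real ^ 3 \<Rightarrow> real ^ 3 \<Rightarrow> real" where
  "lorentz v w = - (v $ 1 * w $ 2 + v $ 2 * w $ 1) + v $ 3 * w $ 3"

definition partial_y :: "(real \<times> real \<Rightarrow> 'a::real_normed_vector) \<Rightarrow> real \<times> real \<Rightarrow> 'a" where
  "partial_y F p = vector_derivative (\<lambda>t. F (t, snd p)) (at (fst p))"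

definition partial_z :: "(real \<times> real \<Rightarrow> 'a::real_normed_vector) \<Rightarrow> real \<times> real \<Rightarrow> 'a" where
  "partial_z F p = vector_derivative (\<lambda>t. F (fst p, t)) (at (snd p))"

definition coeff_E :: "(real \<times> real \<Rightarrow> real ^ 3) \<Rightarrow> real \<times> real \<Rightarrow> real" where
  "coeff_E \<psi> p = lorentz (partial_y \<psi> p) (partial_y \<psi> p)"

definition coeff_F :: "(real \<times> real \<Rightarrow> real ^ 3) \<Rightarrow> real \<times> real \<Rightarrow> real" where
  "coeff_F \<psi> p = lorentz (partial_y \<psi> p) (partial_z \<psi> p)"

definition coeff_G :: "(real \<times> real \<Rightarrow> real ^ 3) \<Rightarrow> real \<times> real \<Rightarrow> real" where
  "coeff_G \<psi> p = lorentz (partial_z \<psi> p) (partial_z \<psi> p)"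

text \<open>A unit normal is timelike or spacelike according to whether the surface is
  spacelike or timelike at the point, so the value \<open>-1\<close> of the metric is allowed.\<close>

definition unit_normal :: "(real \<times> real \<Rightarrow> real ^ 3) \<Rightarrow> real \<times> real \<Rightarrow> real ^ 3 \<Rightarrow> bool" where
  "unit_normal \<psi> p N \<longleftrightarrow>
     lorentz N (partial_y \<psi> p) = 0 \<and> lorentz N (partial_z \<psi> p) = 0 \<and> \<bar>lorentz N N\<bar> = 1"

definition coeff_e :: "(real \<times> real \<Rightarrow> real ^ 3) \<Rightarrow> real ^ 3 \<Rightarrow> real \<times> real \<Rightarrow> real" where
  "coeff_e \<psi> N p = lorentz N (partial_y (partial_y \<psi>) p)"

definition coeff_f :: "(real \<times> real \<Rightarrow> real ^ 3) \<Rightarrow> real ^ 3 \<Rightarrow> real \<times> real \<Rightarrow> real" where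
  "coeff_f \<psi> N p = lorentz N (partial_z (partial_y \<psi>) p)"

definition coeff_g :: "(real \<times> real \<Rightarrow> real ^ 3) \<Rightarrow> real ^ 3 \<Rightarrow> real \<times> real \<Rightarrow> real" where
  "coeff_g \<psi> N p = lorentz N (partial_z (partial_z \<psi>) p)"

text \<open>No extra sign \<open>lorentz N N\<close> is inserted in the quotient.\<close>

definition gauss_curvature :: "(real \<times> real \<Rightarrow> real ^ 3) \<Rightarrow> real ^ 3 \<Rightarrow> real \<times> real \<Rightarrow> real" where
  "gauss_curvature \<psi> N p =
     (coeff_e \<psi> N p * coeff_g \<psi> N p - (coeff_f \<psi> N p)\<^sup>2) /
     (coeff_E \<psi> p * coeff_G \<psi> p - (coeff_F \<psi> p)\<^sup>2)"

text \<open>The first two conjuncts say that the curvature is actually defined at \<open>p\<close>: they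
  exclude \<open>K = 0\<close> by division by zero (degenerate induced metric) or for want of a unit
  normal.\<close>

definition flat_surface :: "(real \<times> real) set \<Rightarrow> (real \<times> real \<Rightarrow> real ^ 3) \<Rightarrow> bool" where
  "flat_surface \<Omega> \<psi> \<longleftrightarrow>
     (\<forall>p\<in>\<Omega>. coeff_E \<psi> p * coeff_G \<psi> p - (coeff_F \<psi> p)\<^sup>2 \<noteq> 0 \<and>
            (\<exists>N. unit_normal \<psi> p N) \<and>
            (\<forall>N. unit_normal \<psi> p N \<longrightarrow> gauss_curvature \<psi> N p = 0))"

definition graph_surface :: "(real \<times> real \<Rightarrow> real) \<Rightarrow> real \<times> real \<Rightarrow> real ^ 3" where
  "graph_surface u = (\<lambda>(y, z). vector [u (y, z), y, z])"

text \<open>Only the values of \<open>u\<close> on \<open>\<Omega>\<close> matter. In types III and IV the argument of the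
  logarithm must not vanish on \<open>\<Omega>\<close>; this has to be said because \<open>ln 0 = 0\<close> in HOL.
  The parameter \<open>l\<close> is the usual \<open>\<lambda>\<close>.\<close>

definition type_I :: "(real \<times> real) set \<Rightarrow> (real \<times> real \<Rightarrow> real) \<Rightarrow> bool" where
  "type_I \<Omega> u \<longleftrightarrow> (\<exists>l>0. \<exists>a0 z0. \<forall>(y, z)\<in>\<Omega>.
     u (y, z) = - 2 * l\<^sup>2 * y + 4 * l\<^sup>2 * ln (cosh ((z - z0) / (2 * l))) + a0)"

definition type_II :: "(real \<times> real) set \<Rightarrow> (real \<times> real \<Rightarrow> real) \<Rightarrow> bool" where
  "type_II \<Omega> u \<longleftrightarrow> (\<exists>a1 b1 b0. a1 \<noteq> 0 \<and> (\<forall>(y, z)\<in>\<Omega>.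
     u (y, z) = a1 * exp (- 2 * y) - b1\<^sup>2 / 2 * y + b1 * z + b0))"

definition type_III :: "(real \<times> real) set \<Rightarrow> (real \<times> real \<Rightarrow> real) \<Rightarrow> bool" where
  "type_III \<Omega> u \<longleftrightarrow> (\<exists>l>0. \<exists>b0 z0. \<forall>(y, z)\<in>\<Omega>.
     cos ((z - z0) / (2 * l)) \<noteq> 0 \<and>
     u (y, z) = 2 * l\<^sup>2 * y - 4 * l\<^sup>2 * ln \<bar>cos ((z - z0) / (2 * l))\<bar> + b0)"

definition type_IV :: "(real \<times> real) set \<Rightarrow> (real \<times> real \<Rightarrow> real) \<Rightarrow> bool" where
  "type_IV \<Omega> u \<longleftrightarrow> (\<exists>l>0. \<exists>a0 z0. \<forall>(y, z)\<in>\<Omega>.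
     sinh ((z - z0) / (2 * l)) \<noteq> 0 \<and>
     u (y, z) = - 2 * l\<^sup>2 * y + 4 * l\<^sup>2 * ln \<bar>sinh ((z - z0) / (2 * l))\<bar> + a0)"

end

theory Submission
  imports Defs
begin

text \<open>
  For the graph \<open>\<psi>(y,z) = (u(y,z), y, z)\<close> one has \<open>\<psi>\<^sub>y = (u\<^sub>y, 1, 0)\<close> and
  \<open>\<psi>\<^sub>z = (u\<^sub>z, 0, 1)\<close>, while the second derivatives of \<open>\<psi>\<close> are multiples of the null
  vector \<open>(1, 0, 0)\<close>. Hence \<open>E = -2 u\<^sub>y\<close>, \<open>F = -u\<^sub>z\<close>, \<open>G = 1\<close>, so that
  \<open>EG - F\<^sup>2 = -2 u\<^sub>y - u\<^sub>z\<^sup>2\<close>, and \<open>eg - f\<^sup>2 = N\<^sub>2\<^sup>2 (u\<^sub>y\<^sub>y u\<^sub>z\<^sub>z - u\<^sub>y\<^sub>z\<^sup>2)\<close> for every normal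
  \<open>N\<close>. A nondegenerate graph is therefore flat as soon as \<open>u\<close> solves the homogeneous
  Monge-Ampere equation (\<open>flat_graph_if_hessian_det_zero\<close>).

  Each of the four types is a sum \<open>A(y) + B(z)\<close> in which one summand is affine, which
  makes the Hessian determinant \<open>A'' B''\<close> vanish (\<open>flat_graph_of_separated_sum\<close>). What
  remains is nondegeneracy, and there
  \<open>-2 u\<^sub>y - u\<^sub>z\<^sup>2\<close> equals \<open>4\<lambda>\<^sup>2 / cosh\<^sup>2\<close>, \<open>4 a\<^sub>1 exp (-2y)\<close>, \<open>-4\<lambda>\<^sup>2 / cos\<^sup>2\<close> and
  \<open>-4\<lambda>\<^sup>2 / sinh\<^sup>2\<close> respectively, the hyperbolic and circular functions being taken at
  \<open>(z - z\<^sub>0) / (2\<lambda>)\<close>.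
\<close>

section \<open>Partial derivatives of maps into Lorentz space\<close>

lemma lorentz_vector:
  "lorentz (vector [a, b, c]) (vector [a', b', c']) = - (a * b' + b * a') + c * c'"
  by (simp add: lorentz_def)

lemma has_vector_derivative_vector_3:
  fixes f g h :: "real \<Rightarrow> real"
  assumes "(f has_real_derivative f') F" "(g has_real_derivative g') F"
    "(h has_real_derivative h') F"
  shows "((\<lambda>t. vector [f t, g t, h t] :: real ^ 3)
           has_vector_derivative vector [f', g', h']) F"
proof -
  have split: "(vector [a, b, c] :: real ^ 3)
      = a *\<^sub>R axis 1 1 + b *\<^sub>R axis 2 1 + c *\<^sub>R axis 3 1" for a b c :: real
    by (simp add: vec_eq_iff forall_3 axis_def)
  show ?thesis
    unfolding split
    using assms[unfolded has_real_derivative_iff_has_vector_derivative]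
    by (intro has_vector_derivative_add
        bounded_linear.has_vector_derivative[OF bounded_linear_scaleR_left])
qed

text \<open>Partial derivatives are local: on an open set only the values of the map on that
  set enter. This is what allows the derivative formulas, which are known on
  \<open>\<Omega>\<close> alone, to be differentiated once more.\<close>

lemma partial_y_vector:
  assumes "open \<Omega>" "p \<in> \<Omega>"
    and F: "\<And>q. q \<in> \<Omega> \<Longrightarrow> F q = (vector [f q, g q, h q] :: real ^ 3)"
    and "((\<lambda>t. f (t, snd p)) has_real_derivative f') (at (fst p))"
      "((\<lambda>t. g (t, snd p)) has_real_derivative g') (at (fst p))"
      "((\<lambda>t. h (t, snd p)) has_real_derivative h') (at (fst p))"
  shows "partial_y F p = vector [f', g', h']"
proof -
  let ?S = "(\<lambda>t. (t, snd p)) -` \<Omega>"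
  have "open ?S"
    using \<open>open \<Omega>\<close> by (intro open_vimage continuous_intros)
  with has_vector_derivative_vector_3[OF assms(4-6)]
  have "((\<lambda>t. F (t, snd p)) has_vector_derivative vector [f', g', h']) (at (fst p))"
    by (rule has_vector_derivative_transform_within_open) (use assms(2) F in auto)
  then show ?thesis
    unfolding partial_y_def by (rule vector_derivative_at)
qed

lemma partial_z_vector:
  assumes "open \<Omega>" "p \<in> \<Omega>"
    and F: "\<And>q. q \<in> \<Omega> \<Longrightarrow> F q = (vector [f q, g q, h q] :: real ^ 3)"
    and "((\<lambda>t. f (fst p, t)) has_real_derivative f') (at (snd p))"
      "((\<lambda>t. g (fst p, t)) has_real_derivative g') (at (snd p))"
      "((\<lambda>t. h (fst p, t)) has_real_derivative h') (at (snd p))"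
  shows "partial_z F p = vector [f', g', h']"
proof -
  let ?S = "(\<lambda>t. (fst p, t)) -` \<Omega>"
  have "open ?S"
    using \<open>open \<Omega>\<close> by (intro open_vimage continuous_intros)
  with has_vector_derivative_vector_3[OF assms(4-6)]
  have "((\<lambda>t. F (fst p, t)) has_vector_derivative vector [f', g', h']) (at (snd p))"
    by (rule has_vector_derivative_transform_within_open) (use assms(2) F in auto)
  then show ?thesis
    unfolding partial_z_def by (rule vector_derivative_at)
qed

section \<open>Flat graphs and the Monge-Ampere equation\<close>

text \<open>A vector \<open>N\<close> is normal to the graph iff it is a multiple of \<open>(-u\<^sub>y, 1, u\<^sub>z)\<close>, whose
  square is \<open>2 u\<^sub>y + u\<^sub>z\<^sup>2 = -(EG - F\<^sup>2)\<close>; so it can be normalised exactly where the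
  induced metric is nondegenerate. The second derivatives of the graph map are
  \<open>(u\<^sub>y\<^sub>y, 0, 0)\<close>, \<open>(u\<^sub>y\<^sub>z, 0, 0)\<close>, \<open>(u\<^sub>z\<^sub>z, 0, 0)\<close>, and their products with \<open>N\<close> all carry the
  factor \<open>-N\<^sub>2\<close>, whence \<open>eg - f\<^sup>2\<close> is a multiple of the Hessian determinant.\<close>

lemma flat_graph_if_hessian_det_zero:
  fixes u uy uz uyy uyz uzz :: "real \<times> real \<Rightarrow> real"
  assumes "open \<Omega>"
    and uy: "\<And>p. p \<in> \<Omega> \<Longrightarrow> ((\<lambda>t. u (t, snd p)) has_real_derivative uy p) (at (fst p))"
    and uz: "\<And>p. p \<in> \<Omega> \<Longrightarrow> ((\<lambda>t. u (fst p, t)) has_real_derivative uz p) (at (snd p))"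
    and uyy: "\<And>p. p \<in> \<Omega> \<Longrightarrow> ((\<lambda>t. uy (t, snd p)) has_real_derivative uyy p) (at (fst p))"
    and uyz: "\<And>p. p \<in> \<Omega> \<Longrightarrow> ((\<lambda>t. uy (fst p, t)) has_real_derivative uyz p) (at (snd p))"
    and uzz: "\<And>p. p \<in> \<Omega> \<Longrightarrow> ((\<lambda>t. uz (fst p, t)) has_real_derivative uzz p) (at (snd p))"
    and nondegenerate: "\<And>p. p \<in> \<Omega> \<Longrightarrow> 2 * uy p + (uz p)\<^sup>2 \<noteq> 0"
    and hessian: "\<And>p. p \<in> \<Omega> \<Longrightarrow> uyy p * uzz p = (uyz p)\<^sup>2"
  shows "flat_surface \<Omega> (graph_surface u)"
  unfolding flat_surface_def
proof (intro ballI)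
  fix p assume p: "p \<in> \<Omega>"
  let ?\<psi> = "graph_surface u"
  have psi: "?\<psi> q = vector [u q, fst q, snd q]" for q
    by (cases q) (simp add: graph_surface_def)
  have psi_y: "partial_y ?\<psi> q = vector [uy q, 1, 0]" if "q \<in> \<Omega>" for q
    using that by (intro partial_y_vector[OF \<open>open \<Omega>\<close> _ psi] uy) auto
  have psi_z: "partial_z ?\<psi> q = vector [uz q, 0, 1]" if "q \<in> \<Omega>" for q
    using that by (intro partial_z_vector[OF \<open>open \<Omega>\<close> _ psi] uz) auto
  have psi_yy: "partial_y (partial_y ?\<psi>) p = vector [uyy p, 0, 0]"
    by (intro partial_y_vector[OF \<open>open \<Omega>\<close> p psi_y] uyy p) auto
  have psi_yz: "partial_z (partial_y ?\<psi>) p = vector [uyz p, 0, 0]"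
    by (intro partial_z_vector[OF \<open>open \<Omega>\<close> p psi_y] uyz p) auto
  have psi_zz: "partial_z (partial_z ?\<psi>) p = vector [uzz p, 0, 0]"
    by (intro partial_z_vector[OF \<open>open \<Omega>\<close> p psi_z] uzz p) auto

  let ?D = "2 * uy p + (uz p)\<^sup>2"
  have D: "?D \<noteq> 0" using nondegenerate[OF p] .
  have "coeff_E ?\<psi> p * coeff_G ?\<psi> p - (coeff_F ?\<psi> p)\<^sup>2 = - ?D"
    by (simp add: coeff_E_def coeff_F_def coeff_G_def psi_y[OF p] psi_z[OF p] lorentz_vector)
  with D have metric: "coeff_E ?\<psi> p * coeff_G ?\<psi> p - (coeff_F ?\<psi> p)\<^sup>2 \<noteq> 0"
    by simp

  define c where "c = 1 / sqrt \<bar>?D\<bar>"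
  have c: "c\<^sup>2 * \<bar>?D\<bar> = 1"
    using D by (simp add: c_def power_divide)
  have "lorentz (vector [- uy p * c, c, uz p * c]) (vector [- uy p * c, c, uz p * c])
      = c\<^sup>2 * ?D"
    by (simp add: lorentz_vector power2_eq_square algebra_simps)
  with c have "unit_normal ?\<psi> p (vector [- uy p * c, c, uz p * c])"
    by (simp add: unit_normal_def psi_y[OF p] psi_z[OF p] lorentz_vector abs_mult)
  then have normal: "\<exists>N. unit_normal ?\<psi> p N" ..

  have "gauss_curvature ?\<psi> N p = 0" for N
  proof -
    have "coeff_e ?\<psi> N p * coeff_g ?\<psi> N p - (coeff_f ?\<psi> N p)\<^sup>2
        = (N $ 2)\<^sup>2 * (uyy p * uzz p - (uyz p)\<^sup>2)"
      by (simp add: coeff_e_def coeff_f_def coeff_g_def psi_yy psi_yz psi_zz lorentz_def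
          power2_eq_square algebra_simps)
    then show ?thesis
      by (simp add: gauss_curvature_def hessian[OF p])
  qed
  with metric normal
  show "coeff_E ?\<psi> p * coeff_G ?\<psi> p - (coeff_F ?\<psi> p)\<^sup>2 \<noteq> 0 \<and>
      (\<exists>N. unit_normal ?\<psi> p N) \<and> (\<forall>N. unit_normal ?\<psi> p N \<longrightarrow> gauss_curvature ?\<psi> N p = 0)"
    by blast
qed

text \<open>The mixed derivative of a separated sum is zero, so the Hessian determinant is
  \<open>A'' B''\<close>. The derivatives are required only over \<open>\<Omega>\<close>, because \<open>B\<close> may have
  logarithmic singularities elsewhere.\<close>

lemma flat_graph_of_separated_sum:
  fixes A A' A'' B B' B'' :: "real \<Rightarrow> real"
  assumes "open \<Omega>"
    and u: "\<And>y z. (y, z) \<in> \<Omega> \<Longrightarrow> u (y, z) = A y + B z"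
    and A: "\<And>y z. (y, z) \<in> \<Omega> \<Longrightarrow> (A has_real_derivative A' y) (at y)"
    and A': "\<And>y z. (y, z) \<in> \<Omega> \<Longrightarrow> (A' has_real_derivative A'' y) (at y)"
    and B: "\<And>y z. (y, z) \<in> \<Omega> \<Longrightarrow> (B has_real_derivative B' z) (at z)"
    and B': "\<And>y z. (y, z) \<in> \<Omega> \<Longrightarrow> (B' has_real_derivative B'' z) (at z)"
    and nondegenerate: "\<And>y z. (y, z) \<in> \<Omega> \<Longrightarrow> 2 * A' y + (B' z)\<^sup>2 \<noteq> 0"
    and product: "\<And>y z. (y, z) \<in> \<Omega> \<Longrightarrow> A'' y * B'' z = 0"
  shows "flat_surface \<Omega> (graph_surface u)"
proof (rule flat_graph_if_hessian_det_zero[OF \<open>open \<Omega>\<close>])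
  fix p assume "p \<in> \<Omega>"
  then obtain y z where p: "p = (y, z)" and yz: "(y, z) \<in> \<Omega>"
    by (cases p) auto
  have "((\<lambda>t. A t + B z) has_real_derivative A' y) (at y)"
    using A[OF yz] by (auto intro!: derivative_eq_intros)
  moreover have "open ((\<lambda>t. (t, z)) -` \<Omega>)"
    using \<open>open \<Omega>\<close> by (intro open_vimage continuous_intros)
  ultimately have "((\<lambda>t. u (t, z)) has_real_derivative A' y) (at y)"
    by (rule has_field_derivative_transform_within_open) (use yz u in auto)
  then show "((\<lambda>t. u (t, snd p)) has_real_derivative A' (fst p)) (at (fst p))"
    by (simp add: p)
  have "((\<lambda>t. A y + B t) has_real_derivative B' z) (at z)"
    using B[OF yz] by (auto intro!: derivative_eq_intros)
  moreover have "open ((\<lambda>t. (y, t)) -` \<Omega>)"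
    using \<open>open \<Omega>\<close> by (intro open_vimage continuous_intros)
  ultimately have "((\<lambda>t. u (y, t)) has_real_derivative B' z) (at z)"
    by (rule has_field_derivative_transform_within_open) (use yz u in auto)
  then show "((\<lambda>t. u (fst p, t)) has_real_derivative B' (snd p)) (at (snd p))"
    by (simp add: p)
  show "((\<lambda>t. A' (fst (t, snd p))) has_real_derivative A'' (fst p)) (at (fst p))"
    using A'[OF yz] by (simp add: p)
  show "((\<lambda>t. A' (fst (fst p, t))) has_real_derivative 0) (at (snd p))"
    by simp
  show "((\<lambda>t. B' (snd (fst p, t))) has_real_derivative B'' (snd p)) (at (snd p))"
    using B'[OF yz] by (simp add: p)
  show "2 * A' (fst p) + (B' (snd p))\<^sup>2 \<noteq> 0"
    using nondegenerate[OF yz] by (simp add: p)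
  show "A'' (fst p) * B'' (snd p) = 0\<^sup>2"
    using product[OF yz] by (simp add: p)
qed

section \<open>The four types of functions\<close>

lemma has_real_derivative_ln_abs:
  assumes "(f has_real_derivative f') (at x)" "f x \<noteq> 0"
  shows "((\<lambda>t. ln \<bar>f t\<bar>) has_real_derivative f' / f x) (at x)"
proof -
  have "isCont f x"
    using assms(1) by (rule DERIV_isCont)
  then have "\<forall>\<^sub>F t in nhds x. 0 < f t * sgn (f x)"
    using assms(2)
    by (intro order_tendstoD(1)[of _ "f x * sgn (f x)"] tendsto_intros)
       (auto simp: isCont_def tendsto_at_iff_tendsto_nhds sgn_if)
  \<comment> \<open>near \<open>x\<close> the sign of \<open>f\<close> is constant, so the absolute value is a constant multiple\<close>
  then have "\<forall>\<^sub>F t in nhds x. ln \<bar>f t\<bar> = ln (sgn (f x) * f t)"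
    by eventually_elim (auto simp: sgn_if abs_if split: if_splits)
  moreover have "((\<lambda>t. ln (sgn (f x) * f t)) has_real_derivative f' / f x) (at x)"
    using assms by (auto intro!: derivative_eq_intros simp: sgn_if)
  ultimately show ?thesis
    by (subst DERIV_cong_ev[OF refl _ refl])
qed

lemma type_I_flat:
  assumes "open \<Omega>" "type_I \<Omega> u"
  shows "flat_surface \<Omega> (graph_surface u)"
proof -
  obtain l a0 z0 where l: "l > 0" and u: "\<And>y z. (y, z) \<in> \<Omega> \<Longrightarrow>
      u (y, z) = - 2 * l\<^sup>2 * y + 4 * l\<^sup>2 * ln (cosh ((z - z0) / (2 * l))) + a0"
    using assms(2) unfolding type_I_def by fast
  define w where "w z = (z - z0) / (2 * l)" for z
  have w: "(w has_real_derivative 1 / (2 * l)) (at z)" for z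
    unfolding w_def using l by (auto intro!: derivative_eq_intros)
  have ch: "cosh (w z) > 0" for z
    by (rule cosh_real_pos)
  show ?thesis
  proof (rule flat_graph_of_separated_sum[where A = "\<lambda>y. - 2 * l\<^sup>2 * y"
        and A' = "\<lambda>_. - 2 * l\<^sup>2" and A'' = "\<lambda>_. 0"
        and B = "\<lambda>z. 4 * l\<^sup>2 * ln (cosh (w z)) + a0"
        and B' = "\<lambda>z. 2 * l * (sinh (w z) / cosh (w z))" and B'' = "\<lambda>z. 1 / (cosh (w z))\<^sup>2"])
    fix y z
    show "((\<lambda>z. 4 * l\<^sup>2 * ln (cosh (w z)) + a0)
        has_real_derivative 2 * l * (sinh (w z) / cosh (w z))) (at z)"
      using l ch[of z]
      by (auto intro!: derivative_eq_intros w simp: field_simps power2_eq_square)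
    have "(cosh (w z))\<^sup>2 - (sinh (w z))\<^sup>2 = 1"
      by (simp add: cosh_square_eq)
    then show "((\<lambda>z. 2 * l * (sinh (w z) / cosh (w z)))
        has_real_derivative 1 / (cosh (w z))\<^sup>2) (at z)"
      using l ch[of z]
      by (auto intro!: derivative_eq_intros w simp: field_simps power2_eq_square)
    have "2 * (- 2 * l\<^sup>2) + (2 * l * (sinh (w z) / cosh (w z)))\<^sup>2
        = - 4 * l\<^sup>2 * ((cosh (w z))\<^sup>2 - (sinh (w z))\<^sup>2) / (cosh (w z))\<^sup>2"
      using ch[of z] by (simp add: field_simps power2_eq_square)
    also have "\<dots> = - 4 * l\<^sup>2 / (cosh (w z))\<^sup>2"
      by (simp add: cosh_square_eq)
    finally show "2 * (- 2 * l\<^sup>2) + (2 * l * (sinh (w z) / cosh (w z)))\<^sup>2 \<noteq> 0"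
      using l ch[of z] by auto
  qed (use assms(1) u in \<open>auto simp: w_def intro!: derivative_eq_intros\<close>)
qed

lemma type_II_flat:
  assumes "open \<Omega>" "type_II \<Omega> u"
  shows "flat_surface \<Omega> (graph_surface u)"
proof -
  obtain a1 b1 b0 where a1: "a1 \<noteq> 0" and u: "\<And>y z. (y, z) \<in> \<Omega> \<Longrightarrow>
      u (y, z) = a1 * exp (- 2 * y) - b1\<^sup>2 / 2 * y + b1 * z + b0"
    using assms(2) unfolding type_II_def by fast
  show ?thesis
    by (rule flat_graph_of_separated_sum[where A = "\<lambda>y. a1 * exp (- 2 * y) - b1\<^sup>2 / 2 * y"
        and A' = "\<lambda>y. - 2 * a1 * exp (- 2 * y) - b1\<^sup>2 / 2" and A'' = "\<lambda>y. 4 * a1 * exp (- 2 * y)"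
        and B = "\<lambda>z. b1 * z + b0" and B' = "\<lambda>_. b1" and B'' = "\<lambda>_. 0"])
      (use assms(1) a1 u in \<open>auto intro!: derivative_eq_intros\<close>)
qed

lemma type_III_flat:
  assumes "open \<Omega>" "type_III \<Omega> u"
  shows "flat_surface \<Omega> (graph_surface u)"
proof -
  obtain l b0 z0 where l: "l > 0"
    and cos: "\<And>y z. (y, z) \<in> \<Omega> \<Longrightarrow> cos ((z - z0) / (2 * l)) \<noteq> 0"
    and u: "\<And>y z. (y, z) \<in> \<Omega> \<Longrightarrow>
      u (y, z) = 2 * l\<^sup>2 * y - 4 * l\<^sup>2 * ln \<bar>cos ((z - z0) / (2 * l))\<bar> + b0"
    using assms(2) unfolding type_III_def by fast
  define w where "w z = (z - z0) / (2 * l)" for z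
  have w: "(w has_real_derivative 1 / (2 * l)) (at z)" for z
    unfolding w_def using l by (auto intro!: derivative_eq_intros)
  show ?thesis
  proof (rule flat_graph_of_separated_sum[where A = "\<lambda>y. 2 * l\<^sup>2 * y"
        and A' = "\<lambda>_. 2 * l\<^sup>2" and A'' = "\<lambda>_. 0"
        and B = "\<lambda>z. b0 - 4 * l\<^sup>2 * ln \<bar>cos (w z)\<bar>"
        and B' = "\<lambda>z. 2 * l * (sin (w z) / cos (w z))" and B'' = "\<lambda>z. 1 / (cos (w z))\<^sup>2"])
    fix y z assume "(y, z) \<in> \<Omega>"
    then have c: "cos (w z) \<noteq> 0"
      using cos by (simp add: w_def)
    have "((\<lambda>z. cos (w z)) has_real_derivative - sin (w z) / (2 * l)) (at z)"
      by (auto intro!: derivative_eq_intros w)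
    from DERIV_diff[OF DERIV_const DERIV_cmult[OF has_real_derivative_ln_abs[OF this c]]]
    show "((\<lambda>z. b0 - 4 * l\<^sup>2 * ln \<bar>cos (w z)\<bar>)
        has_real_derivative 2 * l * (sin (w z) / cos (w z))) (at z)"
      by (rule DERIV_cong) (use l c in \<open>simp add: field_simps power2_eq_square\<close>)
    have "(sin (w z))\<^sup>2 + (cos (w z))\<^sup>2 = 1"
      by simp
    then show "((\<lambda>z. 2 * l * (sin (w z) / cos (w z)))
        has_real_derivative 1 / (cos (w z))\<^sup>2) (at z)"
      using l c by (auto intro!: derivative_eq_intros w simp: field_simps power2_eq_square)
    have "2 * (2 * l\<^sup>2) + (2 * l * (sin (w z) / cos (w z)))\<^sup>2 > 0"
      using l by (intro add_pos_nonneg) auto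
    then show "2 * (2 * l\<^sup>2) + (2 * l * (sin (w z) / cos (w z)))\<^sup>2 \<noteq> 0"
      by simp
  qed (use assms(1) u in \<open>auto simp: w_def intro!: derivative_eq_intros\<close>)
qed

lemma type_IV_flat:
  assumes "open \<Omega>" "type_IV \<Omega> u"
  shows "flat_surface \<Omega> (graph_surface u)"
proof -
  obtain l a0 z0 where l: "l > 0"
    and sinh: "\<And>y z. (y, z) \<in> \<Omega> \<Longrightarrow> sinh ((z - z0) / (2 * l)) \<noteq> 0"
    and u: "\<And>y z. (y, z) \<in> \<Omega> \<Longrightarrow>
      u (y, z) = - 2 * l\<^sup>2 * y + 4 * l\<^sup>2 * ln \<bar>sinh ((z - z0) / (2 * l))\<bar> + a0"
    using assms(2) unfolding type_IV_def by fast
  define w where "w z = (z - z0) / (2 * l)" for z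
  have w: "(w has_real_derivative 1 / (2 * l)) (at z)" for z
    unfolding w_def using l by (auto intro!: derivative_eq_intros)
  show ?thesis
  proof (rule flat_graph_of_separated_sum[where A = "\<lambda>y. - 2 * l\<^sup>2 * y"
        and A' = "\<lambda>_. - 2 * l\<^sup>2" and A'' = "\<lambda>_. 0"
        and B = "\<lambda>z. 4 * l\<^sup>2 * ln \<bar>sinh (w z)\<bar> + a0"
        and B' = "\<lambda>z. 2 * l * (cosh (w z) / sinh (w z))" and B'' = "\<lambda>z. - 1 / (sinh (w z))\<^sup>2"])
    fix y z assume "(y, z) \<in> \<Omega>"
    then have s: "sinh (w z) \<noteq> 0"
      using sinh by (simp only: w_def not_False_eq_True)
    have "((\<lambda>z. sinh (w z)) has_real_derivative cosh (w z) / (2 * l)) (at z)"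
      by (auto intro!: derivative_eq_intros w)
    from DERIV_add[OF DERIV_cmult[OF has_real_derivative_ln_abs[OF this s]] DERIV_const]
    show "((\<lambda>z. 4 * l\<^sup>2 * ln \<bar>sinh (w z)\<bar> + a0)
        has_real_derivative 2 * l * (cosh (w z) / sinh (w z))) (at z)"
      by (rule DERIV_cong) (use l s in \<open>simp add: field_simps power2_eq_square\<close>)
    have "(cosh (w z))\<^sup>2 - (sinh (w z))\<^sup>2 = 1"
      by (simp add: cosh_square_eq)
    then show "((\<lambda>z. 2 * l * (cosh (w z) / sinh (w z)))
        has_real_derivative - 1 / (sinh (w z))\<^sup>2) (at z)"
      using l s by (auto intro!: derivative_eq_intros w simp: field_simps power2_eq_square)
    have "2 * (- 2 * l\<^sup>2) + (2 * l * (cosh (w z) / sinh (w z)))\<^sup>2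
        = 4 * l\<^sup>2 * ((cosh (w z))\<^sup>2 - (sinh (w z))\<^sup>2) / (sinh (w z))\<^sup>2"
      using s by (simp add: field_simps power2_eq_square)
    also have "\<dots> = 4 * l\<^sup>2 / (sinh (w z))\<^sup>2"
      by (simp add: cosh_square_eq)
    finally show "2 * (- 2 * l\<^sup>2) + (2 * l * (cosh (w z) / sinh (w z)))\<^sup>2 \<noteq> 0"
      using l s by auto
  qed (use assms(1) u in \<open>auto simp: w_def intro!: derivative_eq_intros\<close>)
qed

theorem corollary3p1:
  fixes \<Omega> :: "(real \<times> real) set" and u :: "real \<times> real \<Rightarrow> real"
  assumes "open \<Omega>" and "connected \<Omega>" and "\<Omega> \<noteq> {}"
    and "type_I \<Omega> u \<or> type_II \<Omega> u \<or> type_III \<Omega> u \<or> type_IV \<Omega> u"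
  shows "flat_surface \<Omega> (graph_surface u)"
  using assms(1,4) type_I_flat type_II_flat type_III_flat type_IV_flat by blast

end
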